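(* Let $p$ be an odd prime. Denote by $A$ the set of all integers $a$ such that $1 \le a < p$, and both $a$ and $4-a$ are quadratic non-residues. Calculate the remainder when the product of the elements of $A$ is divided by $p$.
   Context: For the given odd prime $p$, an integer $x$ is called a quadratic non-residue if $p$ does not divide $x-t^2$ for any integer $t$. *)

theory Defs
  imports "HOL-Number_Theory.Number_Theory"
begin

definition quad_nonresidue :: "int \<Rightarrow> int \<Rightarrow> bool" where
  "quad_nonresidue p x \<longleftrightarrow> (\<forall>t::int. \<not> p dvd x - t\<^sup>2)"

lemma quad_nonresidue_iff_not_QuadRes: "quad_nonresidue p x \<longleftrightarrow> \<not> QuadRes p x"
  unfolding quad_nonresidue_def QuadRes_def
  by (metis cong_iff_dvd_diff cong_sym_eq)

end

(* Let B be the analogue of A with "residue" in place of "non-residue". The elements a of the union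
   of A and B are those for which a (4 - a) is a nonzero residue. If a is such an element other
   than 2, then b = (a - 2)^2 lies in B, since 4 - b = a (4 - a); conversely each b = c^2 in B comes
   from exactly the two elements 2 + c and 2 - c, whose product is 4 - b. As b |-> 4 - b permutes B,
   the product over the union without 2 is congruent to the product over B. Multiplying by 2 and
   cancelling the product over B leaves 2 for the product over A. *)

theory Submission
  imports Defs
begin

lemma Legendre_cases: "Legendre a p = 0 \<or> Legendre a p = 1 \<or> Legendre a p = -1"
  by (simp add: Legendre_def)

lemma Legendre_cong:
  assumes "[a = b] (mod p)"
  shows "Legendre a p = Legendre b p"
proof -
  have "[a = 0] (mod p) \<longleftrightarrow> [b = 0] (mod p)" "\<And>y. [y = a] (mod p) \<longleftrightarrow> [y = b] (mod p)"
    using assms by (simp_all add: cong_def)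
  then show ?thesis
    by (simp add: Legendre_def QuadRes_def)
qed

lemma Legendre_eq_0_iff: "Legendre a p = 0 \<longleftrightarrow> p dvd a"
  by (auto simp: Legendre_def cong_0_iff)

text \<open>A multiple of \<open>p\<close> is congruent to \<open>0^2\<close>, so it never counts as
  a non-residue; this excludes the value 0 of the symbol.\<close>

lemma quad_nonresidue_iff_Legendre:
  assumes "p \<noteq> 0"
  shows "quad_nonresidue p a \<longleftrightarrow> Legendre a p = -1"
proof -
  have "QuadRes p a" if "[a = 0] (mod p)"
    unfolding QuadRes_def using that by (intro exI[of _ 0]) (simp add: cong_sym)
  then show ?thesis
    by (auto simp: quad_nonresidue_iff_not_QuadRes Legendre_def)
qed

text \<open>The symbol 1 rules out multiples of \<open>p\<close>, so the root \<open>c\<close> is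
  nonzero mod \<open>p\<close>; this later separates \<open>2 + c\<close> from
  \<open>2 - c\<close>.\<close>

lemma Legendre_eq_1_imp_square:
  assumes "Legendre a p = 1"
  obtains c where "[c\<^sup>2 = a] (mod p)" "\<not> p dvd c"
proof -
  from assms obtain c where c: "[c\<^sup>2 = a] (mod p)"
    by (auto simp: Legendre_def QuadRes_def split: if_splits)
  moreover have "\<not> p dvd c"
  proof
    assume "p dvd c"
    then have "p dvd a"
      using c by (metis cong_dvd_iff dvd_mult2 power2_eq_square)
    with assms show False
      by (simp flip: Legendre_eq_0_iff)
  qed
  ultimately show ?thesis by (rule that)
qed

lemma Legendre_square:
  assumes "[c\<^sup>2 = a] (mod p)" "\<not> p dvd a"
  shows "Legendre a p = 1"
  using assms by (auto simp: Legendre_def QuadRes_def cong_0_iff)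

text \<open>By Euler's criterion both sides are congruent to the power of \<open>a * b\<close> with
  exponent \<open>(p - 1) / 2\<close>. Values in {-1, 0, 1} differ by at most 2 < \<open>p\<close>,
  so the congruence is an equality.\<close>

lemma Legendre_mult:
  fixes p :: int
  assumes p: "prime p" "odd p"
  shows "Legendre (a * b) p = Legendre a p * Legendre b p"
proof -
  have "p > 2"
    using p by (metis order_le_less even_numeral prime_ge_2_int)
  \<comment> \<open>Euler's criterion takes the prime as a natural number.\<close>
  define q where "q = nat p"
  have q: "prime q" "2 < q" and pq: "p = int q"
    using p \<open>p > 2\<close> by (auto simp: q_def)
  have euler: "[Legendre x p = x ^ ((q - 1) div 2)] (mod p)" for x
    using euler_criterion[OF q] by (simp add: pq)
  have "[Legendre a p * Legendre b p = (a * b) ^ ((q - 1) div 2)] (mod p)"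
    unfolding power_mult_distrib by (intro cong_mult euler)
  with euler[of "a * b"] have "p dvd Legendre (a * b) p - Legendre a p * Legendre b p"
    by (metis cong_iff_dvd_diff cong_sym cong_trans)
  moreover have "\<bar>Legendre (a * b) p - Legendre a p * Legendre b p\<bar> < p"
    using Legendre_cases[of a p] Legendre_cases[of b p] Legendre_cases[of "a * b" p] \<open>p > 2\<close>
    by auto
  ultimately show ?thesis
    using \<open>p > 2\<close> dvd_imp_le_int[of "Legendre (a * b) p - Legendre a p * Legendre b p" p] by linarith
qed

theorem mainTheorem3:
  fixes p :: int and A :: "int set"
  assumes "prime p" and "odd p"
    and "A = {a. 1 \<le> a \<and> a < p \<and> quad_nonresidue p a \<and> quad_nonresidue p (4 - a)}"
  shows "(\<Prod>a\<in>A. a) mod p = 2"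
proof -
  note p = assms(1,2)
  have p2: "p > 2"
    using p by (metis order_le_less even_numeral prime_ge_2_int)
  define B where "B = {a. 1 \<le> a \<and> a < p \<and> Legendre a p = 1 \<and> Legendre (4 - a) p = 1}"
  define C where "C = {a. 1 \<le> a \<and> a < p \<and> Legendre (a * (4 - a)) p = 1}"
  have A: "A = {a. 1 \<le> a \<and> a < p \<and> Legendre a p = -1 \<and> Legendre (4 - a) p = -1}"
    using assms(3) p2 by (simp add: quad_nonresidue_iff_Legendre)
  have finA: "finite A" and finB: "finite B" and finC: "finite C"
    unfolding A B_def C_def by (rule finite_subset[of _ "{1..<p}"]; auto)+
  have AB: "A \<union> B = C"
  proof -
    \<comment> \<open>Integers with product 1 are both 1 or both -1; by multiplicativity of the
      symbol, the condition defining \<open>C\<close> thus splits into those of \<open>B\<close> and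
      \<open>A\<close>.\<close>
    have "x * y = 1 \<longleftrightarrow> x = 1 \<and> y = 1 \<or> x = -1 \<and> y = -1" for x y :: int
      by (auto simp: zmult_eq_1_iff)
    then show ?thesis
      unfolding A B_def C_def by (auto simp: Legendre_mult[OF p])
  qed
  have disj: "A \<inter> B = {}"
    unfolding A B_def by auto
  have not_dvd2: "\<not> p dvd 2"
    using p2 zdvd_not_zless by auto
  have unit: "\<not> p dvd x" if "1 \<le> x" "x < p" for x
    using that zdvd_not_zless by auto
  have range: "1 \<le> x mod p" "x mod p < p" if "\<not> p dvd x" for x
    using that p2 pos_mod_bound[of p x] pos_mod_sign[of p x]
    by (auto simp: dvd_eq_mod_eq_0 order_le_less)
  \<comment> \<open>The value at 2 is \<open>2 * (4 - 2) = 2^2\<close>. This element is set apart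
    because \<open>(a - 2)^2\<close> vanishes there and so leaves \<open>B\<close>.\<close>
  have "2 \<in> C"
  proof -
    have "Legendre 4 p = 1"
    proof (rule Legendre_square)
      show "[2\<^sup>2 = 4] (mod p)" by simp
      show "\<not> p dvd 4"
        using not_dvd2 prime_dvd_multD[OF p(1), of 2 2] by auto
    qed
    then show ?thesis
      using p2 by (simp add: C_def)
  qed

  let ?g = "\<lambda>a. (a - 2)\<^sup>2 mod p"
  have g: "?g ` (C - {2}) \<subseteq> B"
  proof
    fix b assume "b \<in> ?g ` (C - {2})"
    then obtain a where a: "a \<in> C" "a \<noteq> 2" and b: "b = (a - 2)\<^sup>2 mod p"
      by auto
    \<comment> \<open>Both \<open>a\<close> and 2 lie strictly between 0 and \<open>p\<close>, so
      they are congruent only if equal.\<close>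
    have "\<not> p dvd a - 2"
    proof
      assume "p dvd a - 2"
      then have "a mod p = 2 mod p"
        by (simp add: mod_eq_dvd_iff)
      then show False
        using a p2 by (simp add: C_def)
    qed
    then have sq: "\<not> p dvd (a - 2)\<^sup>2"
      using prime_dvd_power[OF p(1)] by blast
    have cong: "[(a - 2)\<^sup>2 = b] (mod p)"
      by (simp add: b cong_def)
    have "\<not> p dvd b"
      using cong sq cong_dvd_iff by blast
    then have "Legendre b p = 1"
      using cong by (intro Legendre_square)
    moreover have "Legendre (4 - b) p = 1"
    proof -
      have "[4 - b = 4 - (a - 2)\<^sup>2] (mod p)"
        using cong by (intro cong_diff cong_refl) (rule cong_sym)
      also have "4 - (a - 2)\<^sup>2 = a * (4 - a)"
        by (simp add: power2_eq_square algebra_simps)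
      finally show ?thesis
        using a Legendre_cong by (auto simp: C_def)
    qed
    ultimately show "b \<in> B"
      using range[OF sq] by (simp add: B_def b)
  qed
  have fibre: "[\<Prod>{a \<in> C - {2}. ?g a = b} = 4 - b] (mod p)" if "b \<in> B" for b
  proof -
    have b: "1 \<le> b" "b < p" "Legendre b p = 1" "Legendre (4 - b) p = 1"
      using that by (auto simp: B_def)
    from b(3) obtain c where c: "[c\<^sup>2 = b] (mod p)" "\<not> p dvd c"
      by (rule Legendre_eq_1_imp_square)
    let ?x = "(2 + c) mod p" and ?y = "(2 + (- c)) mod p"
    \<comment> \<open>Stated for any square root \<open>d\<close> of \<open>b\<close>, to be used
      with both \<open>c\<close> and \<open>- c\<close>; hence also the form
      \<open>2 + (- c)\<close> in \<open>?y\<close>.\<close>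
    have mem: "(2 + d) mod p \<in> {a \<in> C - {2}. ?g a = b}"
      if d: "[d\<^sup>2 = b] (mod p)" "\<not> p dvd d" for d
    proof -
      let ?a = "(2 + d) mod p"
      have a: "[?a = 2 + d] (mod p)" by simp
      have "[?a * (4 - ?a) = (2 + d) * (4 - (2 + d))] (mod p)"
        by (intro cong_mult cong_diff cong_refl a)
      also have "(2 + d) * (4 - (2 + d)) = 4 - d\<^sup>2"
        by (simp add: power2_eq_square algebra_simps)
      also have "[4 - d\<^sup>2 = 4 - b] (mod p)"
        by (intro cong_diff cong_refl d)
      finally have L: "Legendre (?a * (4 - ?a)) p = 1"
        using b(4) Legendre_cong by metis
      \<comment> \<open>A nonzero symbol keeps the remainder \<open>?a\<close> from being 0, as the
        range condition in \<open>C\<close> requires.\<close>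
      then have "\<not> p dvd ?a * (4 - ?a)"
        by (simp flip: Legendre_eq_0_iff)
      then have "\<not> p dvd 2 + d"
        by (metis dvd_mult2 dvd_mod_iff dvd_refl)
      then have "?a \<in> C"
        using range[of "2 + d"] L by (simp add: C_def)
      moreover have "?a \<noteq> 2"
      proof
        assume "?a = 2"
        then have "[2 + d = 2] (mod p)"
          using p2 by (simp add: cong_def)
        then show False
          using d(2) by (simp add: cong_iff_dvd_diff)
      qed
      moreover have "[(?a - 2)\<^sup>2 = (2 + d - 2)\<^sup>2] (mod p)"
        by (intro cong_pow cong_diff cong_refl a)
      then have "?g ?a = b"
        using d(1) b(1,2) by (simp add: cong_def)
      ultimately show ?thesis by simp
    qed
    have "{a \<in> C - {2}. ?g a = b} = {?x, ?y}"
    proof (intro equalityI subsetI)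
      fix a assume "a \<in> {a \<in> C - {2}. ?g a = b}"
      then have a: "1 \<le> a" "a < p" and "[(a - 2)\<^sup>2 = b] (mod p)"
        using b by (auto simp: C_def cong_def)
      then have "[(a - 2)\<^sup>2 = c\<^sup>2] (mod p)"
        using c(1) cong_sym cong_trans by blast
      \<comment> \<open>The difference of squares \<open>(a - 2)^2 - c^2\<close>, factored so that
        primality of \<open>p\<close> leaves only two candidates for \<open>a\<close>.\<close>
      then have "p dvd (a - (2 + c)) * (a - (2 + (- c)))"
        by (simp add: cong_iff_dvd_diff power2_eq_square algebra_simps)
      then have "p dvd a - (2 + c) \<or> p dvd a - (2 + (- c))"
        using prime_dvd_mult_iff[OF p(1)] by blast
      then have "a mod p = ?x \<or> a mod p = ?y"
        unfolding mod_eq_dvd_iff .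
      then show "a \<in> {?x, ?y}"
        using a by simp
    next
      fix a assume "a \<in> {?x, ?y}"
      then show "a \<in> {a \<in> C - {2}. ?g a = b}"
        using mem[of c] mem[of "- c"] c by auto
    qed
    \<comment> \<open>Equal remainders would make \<open>p\<close> divide the difference
      \<open>2 * c\<close>. Distinctness ensures that the product over the fibre has two
      factors.\<close>
    moreover have "?x \<noteq> ?y"
    proof
      assume "?x = ?y"
      then have "p dvd 2 * c"
        unfolding mod_eq_dvd_iff by simp
      then show False
        using not_dvd2 c(2) prime_dvd_multD[OF p(1)] by blast
    qed
    ultimately have "\<Prod>{a \<in> C - {2}. ?g a = b} = ?x * ?y"
      by simp
    also have "[?x * ?y = (2 + c) * (2 + (- c))] (mod p)"
      by (intro cong_mult) simp_all
    also have "(2 + c) * (2 + (- c)) = 4 - c\<^sup>2"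
      by (simp add: power2_eq_square algebra_simps)
    also have "[4 - c\<^sup>2 = 4 - b] (mod p)"
      by (intro cong_diff cong_refl c)
    finally show ?thesis .
  qed
  \<comment> \<open>The conditions on \<open>b\<close> and \<open>4 - b\<close> are symmetric, so
    the reflection is an involution of \<open>B\<close>, serving below as its own inverse in the
    reindexing.\<close>
  have reflect: "(4 - b) mod p \<in> B" "(4 - (4 - b) mod p) mod p = b" if "b \<in> B" for b
  proof -
    have b: "1 \<le> b" "b < p" "Legendre b p = 1" "Legendre (4 - b) p = 1"
      using that by (auto simp: B_def)
    have "\<not> p dvd 4 - b"
      using b(4) by (simp flip: Legendre_eq_0_iff)
    moreover have "Legendre ((4 - b) mod p) p = 1"
      using b(4) Legendre_cong[of "(4 - b) mod p" "4 - b" p] by simp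
    moreover have "[4 - (4 - b) mod p = 4 - (4 - b)] (mod p)"
      by (intro cong_diff cong_refl) simp
    then have eq: "[4 - (4 - b) mod p = b] (mod p)"
      by simp
    then have "Legendre (4 - (4 - b) mod p) p = 1"
      using b(3) Legendre_cong by metis
    ultimately show "(4 - b) mod p \<in> B"
      using range[of "4 - b"] by (simp add: B_def)
    show "(4 - (4 - b) mod p) mod p = b"
      using eq b(1,2) by (simp add: cong_def)
  qed

  have "\<Prod>(C - {2}) = (\<Prod>b\<in>B. \<Prod>{a \<in> C - {2}. ?g a = b})"
    using finC finB g by (intro prod.group[symmetric]) auto
  also have "[\<dots> = (\<Prod>b\<in>B. 4 - b)] (mod p)"
    by (intro cong_prod fibre)
  also have "[(\<Prod>b\<in>B. 4 - b) = (\<Prod>b\<in>B. (4 - b) mod p)] (mod p)"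
    by (intro cong_prod) simp
  also have "(\<Prod>b\<in>B. (4 - b) mod p) = \<Prod>B"
    by (rule prod.reindex_bij_witness[of _ "\<lambda>b. (4 - b) mod p" "\<lambda>b. (4 - b) mod p"])
      (auto intro: reflect)
  finally have "[2 * \<Prod>(C - {2}) = 2 * \<Prod>B] (mod p)"
    by (intro cong_mult cong_refl)
  \<comment> \<open>The factor 2 restores the removed element: the right side is the product over
    \<open>C\<close>, the disjoint union of \<open>A\<close> and \<open>B\<close>.\<close>
  moreover have "\<Prod>A * \<Prod>B = 2 * \<Prod>(C - {2})"
    using prod.union_disjoint[OF finA finB disj, of "\<lambda>a. a"] prod.remove[OF finC \<open>2 \<in> C\<close>, of "\<lambda>a. a"]
    by (simp add: AB)
  ultimately have "[\<Prod>A * \<Prod>B = 2 * \<Prod>B] (mod p)"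
    by simp
  \<comment> \<open>Every factor lies strictly between 0 and the prime \<open>p\<close>, so the
    product over \<open>B\<close> can be cancelled mod \<open>p\<close>.\<close>
  moreover have "coprime (\<Prod>B) p"
  proof (rule prod_coprime_left)
    fix b assume "b \<in> B"
    then have "\<not> p dvd b"
      using unit by (simp add: B_def)
    then show "coprime b p"
      using p(1) by (metis coprime_commute prime_imp_coprime)
  qed
  ultimately have "[\<Prod>A = 2] (mod p)"
    by (simp add: cong_mult_rcancel)
  then show ?thesis
    using p2 by (simp add: cong_def)
qed

end
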